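(* Let $\lambda = (h_1 +h_2 -l_1-l_2 -\alpha _1-\alpha _2+1 )/2$ and let $(i,i')=(1,2)$ or $(2,1)$. Then the function $$g (x)= x^{\lambda } \sum _{n=0}^{\infty} \Big( \frac{x}{q^{l_i-1/2} t_i} ;q \Big)_n \frac{(q^{\lambda +\alpha _1 };q )_n\, (q^{\lambda +\alpha _2 };q )_n }{(q^{h_i - l_i +1};q )_n\, (q^{h_{i'} - l_i +1} t_{i'} /t_i ;q )_n\, (q;q)_n }\, q^n$$ is a (formal) solution of the variant of the $q$-hypergeometric equation of degree two, i.e. of $$(x-q^{h_1 +1/2} t_1) (x - q^{h_2 +1/2} t_2)\, g(x/q) + q^{\alpha _1 +\alpha _2} (x - q^{l_1-1/2}t_1 ) (x - q^{l_2 -1/2} t_2)\, g(q x) -\big[ (q^{\alpha _1} +q^{\alpha _2} ) x^2 +E x + p ( q^{1/2}+ q^{-1/2}) t_1 t_2 \big]\, g(x) =0,$$ where $p= q^{(h_1 +h_2 + l_1 + l_2 +\alpha _1 +\alpha _2 )/2 }$ and $E= -p \{ (q^{- h_2 }+q^{-l_2 })t_1 + (q^{- h_1 }+ q^{- l_1 }) t_2 \}$.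
   Context: Here $q$ is a fixed nonzero complex number that is not a root of unity, with a fixed choice of $\log q$ so that $q^s=e^{s\log q}$; $h_1,h_2,l_1,l_2,\alpha_1,\alpha_2$ are complex parameters and $t_1,t_2$ are nonzero complex parameters, such that no denominator appearing vanishes. The $q$-Pochhammer symbol is $(a;q)_0=1$, $(a;q)_n=(1-a)(1-aq)\cdots(1-aq^{n-1})$ for $n\ge 1$. The power $x^{s}$ satisfies $(q^{\pm1}x)^{s}=q^{\pm s}x^{s}$. Infinite sums are treated formally and convergence is not discussed. Precisely, put $P_n(x)=\big(x/(q^{l_i-1/2}t_i);q\big)_n$, which form a basis of the polynomials in $x$, and let $L$ be the linear operator sending $g$ to the left-hand side of the equation. For each $n\ge 0$, $x^{-\lambda}L[x^{\lambda}P_n]$ is a polynomial which is a linear combination of the $P_m$ with $\max(n-1,0)\le m\le n+2$. A formal series $g=x^\lambda\sum_{n\ge0}c_nP_n(x)$ is a formal solution if, applying $L$ termwise, writing each term as such a linear combination of the $P_m$, and collecting terms, the total coefficient (a finite sum) of each $P_m$, $m\ge0$, is zero. *)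

theory Defs
  imports "HOL-Analysis.Analysis"
begin

text \<open>
  Throughout, \<open>lq\<close> is the fixed choice of \<open>log q\<close>.  Pairs of parameters such as
  \<open>h\<^sub>1, h\<^sub>2\<close> are functions on \<open>nat\<close>, used at the arguments 1 and 2 only.
\<close>

definition qpow :: "complex \<Rightarrow> complex \<Rightarrow> complex" where
  "qpow lq s = exp (s * lq)"

definition qpoch :: "complex \<Rightarrow> complex \<Rightarrow> nat \<Rightarrow> complex" where
  "qpoch a q n = (\<Prod>k<n. 1 - a * q ^ k)"

text \<open>
  \<open>X\<close> plays the role of \<open>x \<mapsto> x\<^sup>s\<close> on the nonzero complex numbers.  The principal branch
  \<open>x powr s\<close> does not qualify, since it fails the \<open>q\<close>-shift rule across its branch cut; only
  the shift rule matters, and such functions exist (lemma \<open>power_function_exists\<close>).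
\<close>

definition power_function ::
    "complex \<Rightarrow> complex \<Rightarrow> complex \<Rightarrow> (complex \<Rightarrow> complex) \<Rightarrow> bool" where
  "power_function q lq s X \<longleftrightarrow>
     (\<forall>x. x \<noteq> 0 \<longrightarrow>
        X x \<noteq> 0 \<and> X (q * x) = qpow lq s * X x \<and> X (x / q) = qpow lq (- s) * X x)"

definition coeff_p ::
    "complex \<Rightarrow> (nat \<Rightarrow> complex) \<Rightarrow> (nat \<Rightarrow> complex) \<Rightarrow> (nat \<Rightarrow> complex) \<Rightarrow> complex" where
  "coeff_p lq h l \<alpha> = qpow lq ((h 1 + h 2 + l 1 + l 2 + \<alpha> 1 + \<alpha> 2) / 2)"

definition coeff_E ::
    "complex \<Rightarrow> (nat \<Rightarrow> complex) \<Rightarrow> (nat \<Rightarrow> complex) \<Rightarrow> (nat \<Rightarrow> complex) \<Rightarrow> (nat \<Rightarrow> complex)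
      \<Rightarrow> complex" where
  "coeff_E lq h l \<alpha> t =
     - coeff_p lq h l \<alpha> *
       ((qpow lq (- h 2) + qpow lq (- l 2)) * t 1 + (qpow lq (- h 1) + qpow lq (- l 1)) * t 2)"

definition qhyp2_operator ::
    "complex \<Rightarrow> complex \<Rightarrow> (nat \<Rightarrow> complex) \<Rightarrow> (nat \<Rightarrow> complex) \<Rightarrow> (nat \<Rightarrow> complex) \<Rightarrow> (nat \<Rightarrow> complex)
      \<Rightarrow> (complex \<Rightarrow> complex) \<Rightarrow> (complex \<Rightarrow> complex)" where
  "qhyp2_operator q lq h l \<alpha> t g = (\<lambda>x.
       (x - qpow lq (h 1 + 1/2) * t 1) * (x - qpow lq (h 2 + 1/2) * t 2) * g (x / q)
     + qpow lq (\<alpha> 1 + \<alpha> 2) *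
         (x - qpow lq (l 1 - 1/2) * t 1) * (x - qpow lq (l 2 - 1/2) * t 2) * g (q * x)
     - ((qpow lq (\<alpha> 1) + qpow lq (\<alpha> 2)) * x\<^sup>2 + coeff_E lq h l \<alpha> t * x
         + coeff_p lq h l \<alpha> * (qpow lq (1/2) + qpow lq (- 1/2)) * t 1 * t 2) * g x)"

text \<open>
  The formal series \<open>X(x) * (\<Sum>n. c n * P n x)\<close> is annihilated by \<open>L\<close>: each \<open>L[X * P n]\<close> is
  \<open>X\<close> times \<open>\<Sum>m. a n m * P m\<close> with \<open>n - 1 \<le> m \<le> n + 2\<close> (truncated subtraction gives the bound
  \<open>max (n - 1) 0\<close>), and for each \<open>m\<close> the contributions \<open>c n * a n m\<close> sum to zero.  The indices \<open>n\<close>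
  contributing to a given \<open>m\<close> are exactly \<open>m - 2, \<dots>, m + 1\<close>.  When the \<open>P m\<close> are linearly
  independent as functions on the nonzero numbers, the \<open>a n m\<close> in this range are unique.
\<close>

definition formal_solution ::
    "((complex \<Rightarrow> complex) \<Rightarrow> (complex \<Rightarrow> complex)) \<Rightarrow> (complex \<Rightarrow> complex)
      \<Rightarrow> (nat \<Rightarrow> complex \<Rightarrow> complex) \<Rightarrow> (nat \<Rightarrow> complex) \<Rightarrow> bool" where
  "formal_solution L X P c \<longleftrightarrow>
     (\<exists>a :: nat \<Rightarrow> nat \<Rightarrow> complex.
        (\<forall>n x. x \<noteq> 0 \<longrightarrow>
           L (\<lambda>y. X y * P n y) x = X x * (\<Sum>m = n - 1..n + 2. a n m * P m x)) \<and>
        (\<forall>m. (\<Sum>n = m - 2..m + 1. c n * a n m) = 0))"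

lemma power_function_exists:
  assumes q: "exp lq = q" and nru: "\<forall>n>0. q ^ n \<noteq> 1"
  shows "\<exists>X. power_function q lq s X"
proof -
  have q0: "q \<noteq> 0" using q by auto
  have inj: "k = j" if "q powi k = q powi j" for k j :: int
  proof -
    have one: "d = 0" if "q powi d = 1" for d :: int
    proof (rule ccontr)
      assume "d \<noteq> 0"
      then have "nat \<bar>d\<bar> > 0" by simp
      moreover have "q ^ nat \<bar>d\<bar> = 1"
        using that q0 by (cases "d \<ge> 0") (auto simp: power_int_def power_inverse)
      ultimately show False using nru by blast
    qed
    have "q powi (k - j) = 1" using that q0 by (simp add: power_int_diff)
    from one[OF this] show ?thesis by simp
  qed
  define R where "R x y \<longleftrightarrow> (\<exists>k::int. x = q powi k * y)" for x y :: complex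
  define r where "r x = (SOME y. R x y)" for x
  have Rshift: "R (q * x) = R x" for x
  proof (rule ext, rule iffI)
    fix y assume "R (q * x) y"
    then obtain k where "q * x = q powi k * y" unfolding R_def by blast
    then have "x = q powi (k - 1) * y" using q0 by (simp add: power_int_diff field_simps)
    then show "R x y" unfolding R_def by blast
  next
    fix y assume "R x y"
    then obtain k where "x = q powi k * y" unfolding R_def by blast
    then have "q * x = q powi (k + 1) * y" using q0 by (simp add: power_int_add)
    then show "R (q * x) y" unfolding R_def by blast
  qed
  have "R x x" for x unfolding R_def by (rule exI[of _ 0]) simp
  then have Rr: "R x (r x)" for x unfolding r_def by (rule someI)
  define k where "k x = (SOME k::int. x = q powi k * r x)" for x
  have k: "x = q powi (k x) * r x" for x
    unfolding k_def using Rr[of x] unfolding R_def by (rule someI_ex)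
  have kshift: "k (q * x) = k x + 1" if "x \<noteq> 0" for x
  proof -
    have rr: "r (q * x) = r x" unfolding r_def Rshift ..
    have r0: "r x \<noteq> 0" using k[of x] that by auto
    have "q powi (k (q * x)) * r x = q * x" using k[of "q * x"] rr by simp
    also have "\<dots> = q * (q powi (k x) * r x)" using k[of x] by simp
    also have "\<dots> = q powi (k x + 1) * r x" using q0 by (simp add: power_int_add)
    finally show ?thesis using r0 inj by simp
  qed
  define X where "X x = exp (of_int (k x) * (s * lq))" for x
  have up: "X (q * x) = qpow lq s * X x" if "x \<noteq> 0" for x
    unfolding X_def qpow_def kshift[OF that] by (simp add: ring_distribs exp_add)
  have "power_function q lq s X"
    unfolding power_function_def
  proof (intro allI impI conjI)
    fix x :: complex assume x: "x \<noteq> 0"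
    show "X x \<noteq> 0" by (simp add: X_def)
    show "X (q * x) = qpow lq s * X x" by (rule up[OF x])
    have "X x = qpow lq s * X (x / q)" using up[of "x / q"] x q0 by simp
    then show "X (x / q) = qpow lq (- s) * X x" by (simp add: qpow_def exp_minus)
  qed
  then show ?thesis by blast
qed

end

theory Submission
  imports Defs
begin

text \<open>
  Put \<open>b = q^(l\<^sub>i - 1/2) t\<^sub>i\<close>, \<open>z = x / b\<close>, \<open>U = q^(h\<^sub>i - l\<^sub>i)\<close>, \<open>V = q^(h\<^sub>i\<^sub>' - l\<^sub>i) t\<^sub>i\<^sub>' / t\<^sub>i\<close>,
  \<open>A = q^(\<lambda> + \<alpha>\<^sub>1)\<close> and \<open>C = q^(\<lambda> + \<alpha>\<^sub>2)\<close>.  The choice of \<open>\<lambda>\<close> makes the constant and the linear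
  term of \<open>x^(-\<lambda>) L[x^\<lambda>]\<close> vanish.  The same choice makes \<open>x^(-\<lambda>) L[x^\<lambda> P\<^sub>n]\<close> divisible by \<open>x\<^sup>2\<close>
  for every \<open>n\<close>, and in fact
  \<open>x^(-\<lambda>) L[x^\<lambda> P\<^sub>n] = q^(-\<lambda>-n) x\<^sup>2 ((1 - A q^n) (1 - C q^n) P\<^sub>n
      - (1 - q^n) (1 - U q^n) (1 - V q^n) P\<^sub>n\<^sub>-\<^sub>1)\<close>.
  So the four-term action on the basis is a two-term action followed by multiplication by \<open>x\<^sup>2\<close>,
  which sends \<open>P\<^sub>n\<close> to a combination of \<open>P\<^sub>n, P\<^sub>n\<^sub>+\<^sub>1, P\<^sub>n\<^sub>+\<^sub>2\<close>.  The coefficients \<open>c\<^sub>n\<close> of the series are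
  exactly those with \<open>c\<^sub>0 = 1\<close> and
  \<open>c\<^sub>n\<^sub>+\<^sub>1 (1 - q^(n+1)) (1 - U q^(n+1)) (1 - V q^(n+1)) = q c\<^sub>n (1 - A q^n) (1 - C q^n)\<close>,
  so the part of \<open>L[x^\<lambda> c\<^sub>n P\<^sub>n]\<close> that involves \<open>x\<^sup>2 P\<^sub>n\<close> cancels the part of
  \<open>L[x^\<lambda> c\<^sub>n\<^sub>+\<^sub>1 P\<^sub>n\<^sub>+\<^sub>1]\<close> that does, and the sum over \<open>n\<close> telescopes.

  The two-term formula is a polynomial identity in \<open>z\<close>, proved in \<open>two_term_action\<close> after the
  operator has been rewritten in the variables above (\<open>qhyp2_operator_normalized\<close>); the
  cancellation is \<open>formal_solution_if_telescoping\<close>.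
\<close>

section \<open>Powers of q and q-Pochhammer symbols\<close>

lemma qpow_add: "qpow lq (a + b) = qpow lq a * qpow lq b"
  by (simp add: qpow_def exp_add distrib_right)

lemma qpow_diff: "qpow lq (a - b) = qpow lq a / qpow lq b"
  by (simp add: qpow_def exp_diff left_diff_distrib)

lemma qpow_minus: "qpow lq (- a) = inverse (qpow lq a)"
  by (simp add: qpow_def exp_minus)

lemma qpow_nonzero [simp]: "qpow lq a \<noteq> 0"
  by (simp add: qpow_def)

lemma qpow_one: "qpow lq 1 = exp lq"
  by (simp add: qpow_def)

lemma qpoch_0 [simp]: "qpoch a q 0 = 1"
  by (simp add: qpoch_def)

lemma qpoch_Suc: "qpoch a q (Suc n) = qpoch a q n * (1 - a * q ^ n)"
  by (simp add: qpoch_def)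

lemma qpoch_Suc_left: "qpoch a q (Suc n) = (1 - a) * qpoch (a * q) q n"
  by (simp add: qpoch_def prod.lessThan_Suc_shift mult.assoc del: prod.lessThan_Suc)

lemma qpoch_self_nonzero:
  assumes "\<forall>n>0. q ^ n \<noteq> 1"
  shows "qpoch q q n \<noteq> 0"
proof -
  have "1 - q * q ^ k \<noteq> 0" for k
    using assms[rule_format, of "Suc k"] by simp
  then show ?thesis by (simp add: qpoch_def)
qed

text \<open>
  Multiplication by \<open>z\<close> is bidiagonal in the basis, because \<open>1 - z q^n\<close> is the factor that leads
  from one basis element to the next; this is that rule applied twice.
\<close>

lemma square_times_qpoch:
  assumes "q \<noteq> 0"
  shows "z\<^sup>2 * qpoch z q n =
    (inverse (q ^ n))\<^sup>2 *
      (qpoch z q n - (1 + inverse q) * qpoch z q (Suc n) + inverse q * qpoch z q (Suc (Suc n)))"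
proof -
  have "q ^ n \<noteq> 0" using assms by simp
  then show ?thesis using assms
    by (simp add: qpoch_Suc field_simps power2_eq_square)
qed

section \<open>The action on the q-Pochhammer basis\<close>

text \<open>
  All three values \<open>(z/q;q)\<^sub>n\<close>, \<open>(1 - z) (qz;q)\<^sub>n\<close> and \<open>(z;q)\<^sub>n\<close> are multiples of \<open>(z;q)\<^sub>n\<^sub>-\<^sub>1\<close>, so
  that only an identity between cubic polynomials in \<open>z\<close> remains.  In the case \<open>n = 0\<close> the
  truncated index \<open>n - 1\<close> is harmless since \<open>1 - q ^ n\<close> vanishes.
\<close>

lemma two_term_action:
  assumes q: "q \<noteq> 0"
  shows "(z - q * U) * (z - q * V) * qpoch (z / q) q n
      + (z - 1) * (A * C * z - q * U * V) * qpoch (q * z) q n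
      - ((A + C) * z\<^sup>2 - (q * U + q * V + A * C + q * U * V) * z + q * U * V * (1 + q)) * qpoch z q n
    = z\<^sup>2 * inverse (q ^ n) *
        ((1 - A * q ^ n) * (1 - C * q ^ n) * qpoch z q n
         - (1 - q ^ n) * (1 - U * q ^ n) * (1 - V * q ^ n) * qpoch z q (n - 1))"
proof (cases n)
  case 0
  then show ?thesis by (simp add: algebra_simps power2_eq_square)
next
  case (Suc k)
  define w where "w = q ^ k"
  define B where "B = qpoch z q k"
  have w: "w \<noteq> 0" using q by (simp add: w_def)
  have down: "qpoch (z / q) q n = (1 - z / q) * B"
    using q by (simp add: Suc qpoch_Suc_left B_def)
  have same: "qpoch z q n = B * (1 - z * w)"
    by (simp add: Suc qpoch_Suc B_def w_def)
  have "(1 - z) * qpoch (q * z) q n = qpoch z q (Suc n)"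
    by (simp add: qpoch_Suc_left mult.commute)
  also have "\<dots> = B * (1 - z * w) * (1 - z * (q * w))"
    by (simp add: Suc qpoch_Suc B_def w_def)
  finally have up: "(z - 1) * qpoch (q * z) q n = - (B * (1 - z * w) * (1 - z * (q * w)))"
    by (simp add: algebra_simps)
  have cubic: "(z - q * U) * (z - q * V) * (1 - z / q)
      - (A * C * z - q * U * V) * ((1 - z * w) * (1 - z * (q * w)))
      - ((A + C) * z\<^sup>2 - (q * U + q * V + A * C + q * U * V) * z + q * U * V * (1 + q)) * (1 - z * w)
    = z\<^sup>2 * inverse (q * w) *
        ((1 - A * (q * w)) * (1 - C * (q * w)) * (1 - z * w)
         - (1 - q * w) * (1 - U * (q * w)) * (1 - V * (q * w)))" (is "?l = ?r")
    using q w by (simp add: field_simps power2_eq_square)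
  have "(z - q * U) * (z - q * V) * qpoch (z / q) q n
      + (z - 1) * (A * C * z - q * U * V) * qpoch (q * z) q n
      - ((A + C) * z\<^sup>2 - (q * U + q * V + A * C + q * U * V) * z + q * U * V * (1 + q)) * qpoch z q n
    = (z - q * U) * (z - q * V) * qpoch (z / q) q n
      + (A * C * z - q * U * V) * ((z - 1) * qpoch (q * z) q n)
      - ((A + C) * z\<^sup>2 - (q * U + q * V + A * C + q * U * V) * z + q * U * V * (1 + q)) * qpoch z q n"
    by simp
  also have "\<dots> = B * ?l"
    unfolding down same up by (simp add: algebra_simps)
  also have "\<dots> = B * ?r"
    by (simp only: cubic)
  also have "\<dots> = z\<^sup>2 * inverse (q ^ n) *
        ((1 - A * q ^ n) * (1 - C * q ^ n) * qpoch z q n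
         - (1 - q ^ n) * (1 - U * q ^ n) * (1 - V * q ^ n) * qpoch z q (n - 1))"
    unfolding same by (simp add: Suc w_def B_def algebra_simps)
  finally show ?thesis .
qed

text \<open>
  The hypothesis on \<open>lam\<close> gives that the product \<open>q^(h\<^sub>1 + h\<^sub>2 + 1)\<close> equals
  \<open>q^(2 \<lambda> + l\<^sub>1 + l\<^sub>2 + \<alpha>\<^sub>1 + \<alpha>\<^sub>2)\<close>.  This is what makes the coefficients of \<open>z\<close> and of \<open>1\<close> in
  the multiplier of \<open>f x\<close> expressible by those of the two shifted terms.  The second root of the
  coefficient of \<open>f (q * x)\<close> is \<open>z = q U V / (A C)\<close> for the same reason.
\<close>

lemma qhyp2_operator_normalized:
  fixes q lq lam :: complex
    and h l \<alpha> t :: "nat \<Rightarrow> complex"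
  assumes log_q: "exp lq = q"
    and t_nonzero: "t 1 \<noteq> 0" "t 2 \<noteq> 0"
    and lam: "lam = (h 1 + h 2 - l 1 - l 2 - \<alpha> 1 - \<alpha> 2 + 1) / 2"
    and ii': "(i, i') = (1, 2) \<or> (i, i') = (2, 1)"
    and X: "power_function q lq lam X"
    and x: "x \<noteq> 0"
  defines "b \<equiv> qpow lq (l i - 1/2) * t i"
    and "U \<equiv> qpow lq (h i - l i)"
    and "V \<equiv> qpow lq (h i' - l i) * t i' / t i"
    and "A \<equiv> qpow lq (lam + \<alpha> 1)"
    and "C \<equiv> qpow lq (lam + \<alpha> 2)"
  defines "z \<equiv> x / b"
  shows "qhyp2_operator q lq h l \<alpha> t (\<lambda>y. X y * f y) x =
    X x * (b\<^sup>2 * qpow lq (- lam) *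
      ((z - q * U) * (z - q * V) * f (x / q)
       + (z - 1) * (A * C * z - q * U * V) * f (q * x)
       - ((A + C) * z\<^sup>2 - (q * U + q * V + A * C + q * U * V) * z + q * U * V * (1 + q)) * f x))"
proof -
  define H K M N r a c \<Lambda> s s' where gens:
    "H = qpow lq (h i)" "K = qpow lq (h i')" "M = qpow lq (l i)" "N = qpow lq (l i')"
    "r = qpow lq (1/2)" "a = qpow lq (\<alpha> 1)" "c = qpow lq (\<alpha> 2)" "\<Lambda> = qpow lq lam"
    "s = t i" "s' = t i'"
  have nz: "H \<noteq> 0" "K \<noteq> 0" "M \<noteq> 0" "N \<noteq> 0" "r \<noteq> 0" "a \<noteq> 0" "c \<noteq> 0" "\<Lambda> \<noteq> 0" "s \<noteq> 0" "s' \<noteq> 0"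
    using t_nonzero ii' by (auto simp: gens)
  have q: "q = r * r"
    using log_q by (simp add: gens qpow_def flip: exp_add)
  have twice_lam: "lam + lam = h i + h i' - l i - l i' - \<alpha> 1 - \<alpha> 2 + 1"
    using ii' unfolding lam field_sum_of_halves by auto
  have lam': "h i + h i' + 1/2 + 1/2 = lam + lam + l i + l i' + \<alpha> 1 + \<alpha> 2"
    unfolding twice_lam by simp
  have rel: "H * K * r * r = \<Lambda> * \<Lambda> * M * N * a * c"
    using arg_cong[OF lam', of "qpow lq"] unfolding qpow_add gens .
  \<comment> \<open>Eliminating \<open>K\<close> leaves independent nonzero variables, so that the coefficient
    comparisons below become identities of rational functions.\<close>
  have K: "K = \<Lambda> * \<Lambda> * M * N * a * c / (H * r * r)"
    using rel nz by (simp add: field_simps)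
  have "2 * (lam + l i + l i' + \<alpha> 1 + \<alpha> 2 - 1/2) =
      lam + lam + 2 * (l i + l i' + \<alpha> 1 + \<alpha> 2) - 1"
    by simp
  also have "\<dots> = h 1 + h 2 + l 1 + l 2 + \<alpha> 1 + \<alpha> 2"
    unfolding twice_lam using ii' by auto
  finally have p_exponent: "(h 1 + h 2 + l 1 + l 2 + \<alpha> 1 + \<alpha> 2) / 2 = lam + l i + l i' + \<alpha> 1 + \<alpha> 2 - 1/2"
    by (metis nonzero_mult_div_cancel_left zero_neq_numeral)
  have p: "coeff_p lq h l \<alpha> = \<Lambda> * M * N * a * c / r"
    unfolding coeff_p_def p_exponent by (simp add: qpow_add qpow_diff gens)
  have E: "coeff_E lq h l \<alpha> t =
      - coeff_p lq h l \<alpha> * ((inverse K + inverse N) * s + (inverse H + inverse M) * s')"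
    using ii' unfolding coeff_E_def by (auto simp: gens qpow_minus algebra_simps)
  have Xs: "X (q * x) = \<Lambda> * X x" "X (x / q) = inverse \<Lambda> * X x"
    using X x by (simp_all add: power_function_def gens qpow_minus)
  have b: "b = M / r * s" and U: "U = H / M" and V: "V = K / M * s' / s"
    and A: "A = \<Lambda> * a" and C: "C = \<Lambda> * c"
    by (simp_all add: b_def U_def V_def A_def C_def gens qpow_add qpow_diff)
  have bnz: "b \<noteq> 0" using nz by (simp add: b)
  have xz: "x = b * z" using bnz by (simp add: z_def)
  have op: "qhyp2_operator q lq h l \<alpha> t (\<lambda>y. X y * f y) x =
     (x - H * r * s) * (x - K * r * s') * (inverse \<Lambda> * X x * f (x / q))
     + a * c * (x - b) * (x - N / r * s') * (\<Lambda> * X x * f (q * x))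
     - ((a + c) * x\<^sup>2 + coeff_E lq h l \<alpha> t * x
         + coeff_p lq h l \<alpha> * (r + inverse r) * s * s') * (X x * f x)"
    using ii' unfolding qhyp2_operator_def Xs
    by (auto simp: gens b_def qpow_add qpow_diff qpow_minus mult_ac)
  have down: "(x - H * r * s) * (x - K * r * s') = b\<^sup>2 * ((z - q * U) * (z - q * V))"
    unfolding xz q U V b using nz by (simp add: field_simps power2_eq_square)
  have up: "a * c * \<Lambda> * ((x - b) * (x - N / r * s')) =
      b\<^sup>2 * inverse \<Lambda> * ((z - 1) * (A * C * z - q * U * V))"
    unfolding xz q U V A C b K using nz by (simp add: field_simps power2_eq_square)
  have mid: "(a + c) * x\<^sup>2 + coeff_E lq h l \<alpha> t * x + coeff_p lq h l \<alpha> * (r + inverse r) * s * s' =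
      b\<^sup>2 * inverse \<Lambda> *
        ((A + C) * z\<^sup>2 - (q * U + q * V + A * C + q * U * V) * z + q * U * V * (1 + q))"
    unfolding E p xz q U V A C b K using nz by (simp add: field_simps power2_eq_square)
  have "qhyp2_operator q lq h l \<alpha> t (\<lambda>y. X y * f y) x =
     X x * ((x - H * r * s) * (x - K * r * s') * inverse \<Lambda> * f (x / q)
     + a * c * \<Lambda> * ((x - b) * (x - N / r * s')) * f (q * x)
     - ((a + c) * x\<^sup>2 + coeff_E lq h l \<alpha> t * x
         + coeff_p lq h l \<alpha> * (r + inverse r) * s * s') * f x)"
    unfolding op by (simp only: algebra_simps)
  also have "\<dots> = X x * (b\<^sup>2 * inverse \<Lambda> *
      ((z - q * U) * (z - q * V) * f (x / q)
       + (z - 1) * (A * C * z - q * U * V) * f (q * x)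
       - ((A + C) * z\<^sup>2 - (q * U + q * V + A * C + q * U * V) * z + q * U * V * (1 + q)) * f x))"
    unfolding down up mid by (simp only: algebra_simps)
  finally show ?thesis by (simp add: gens qpow_minus)
qed

section \<open>Telescoping formal series\<close>

text \<open>
  The contribution of \<open>R n\<close> to \<open>L[c\<^sub>n X P\<^sub>n]\<close> is cancelled by its contribution to
  \<open>L[c\<^sub>n\<^sub>+\<^sub>1 X P\<^sub>n\<^sub>+\<^sub>1]\<close>.  For fixed \<open>m\<close> the sum of the coefficients of \<open>P m\<close> telescopes, and the
  boundary terms vanish because \<open>R n\<close> involves only \<open>P n, \<dots>, P (n + 2)\<close>.
\<close>

lemma formal_solution_if_telescoping:
  fixes L :: "(complex \<Rightarrow> complex) \<Rightarrow> (complex \<Rightarrow> complex)"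
    and P R :: "nat \<Rightarrow> complex \<Rightarrow> complex"
    and c \<beta> \<delta> :: "nat \<Rightarrow> complex"
  assumes R: "\<And>n x. R n x = (\<Sum>m = n..n + 2. e n m * P m x)"
    and L: "\<And>n x. x \<noteq> 0 \<Longrightarrow>
      L (\<lambda>y. X y * P n y) x = X x * (\<beta> n * R n x - \<delta> n * R (n - 1) x)"
    and \<delta>0: "\<delta> 0 = 0"
    and c: "\<And>n. c (Suc n) * \<delta> (Suc n) = c n * \<beta> n"
  shows "formal_solution L X P c"
proof -
  define e' where "e' n m = (if m \<in> {n..n + 2} then e n m else 0)" for n m
  \<comment> \<open>The cut-off of \<open>e\<close> lets all the sums over \<open>m\<close> run over one common range.\<close>
  define a where "a n m = \<beta> n * e' n m - \<delta> n * e' (n - 1) m" for n m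
  have R': "R n x = (\<Sum>m\<in>S. e' n m * P m x)" if "finite S" "{n..n + 2} \<subseteq> S" for n x S
    unfolding R using that by (intro sum.mono_neutral_cong_left) (auto simp: e'_def)
  have "\<beta> n * R n x - \<delta> n * R (n - 1) x = (\<Sum>m = n - 1..n + 2. a n m * P m x)" for n x
  proof -
    have Rn: "R n x = (\<Sum>m = n - 1..n + 2. e' n m * P m x)"
      by (rule R') auto
    have Rn1: "R (n - 1) x = (\<Sum>m = n - 1..n + 2. e' (n - 1) m * P m x)"
      by (rule R') auto
    show ?thesis unfolding Rn Rn1
      by (simp only: a_def left_diff_distrib sum_subtractf sum_distrib_left mult.assoc)
  qed
  with L have "L (\<lambda>y. X y * P n y) x = X x * (\<Sum>m = n - 1..n + 2. a n m * P m x)"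
    if "x \<noteq> 0" for n x
    using that by simp
  moreover have "(\<Sum>n = m - 2..m + 1. c n * a n m) = 0" for m
  proof -
    define G where "G n = c n * \<beta> n * e' n m" for n
    have step: "c (Suc n) * a (Suc n) m = G (Suc n) - G n" for n
      by (simp add: a_def G_def right_diff_distrib c flip: mult.assoc)
    have "c 0 * a 0 m = G 0"
      by (simp add: a_def G_def \<delta>0)
    then have "(\<Sum>n\<le>k. c n * a n m) = G k" for k
      by (induction k) (simp_all add: step)
    from this[of "m + 1"] have "(\<Sum>n\<le>m + 1. c n * a n m) = 0"
      by (simp add: G_def e'_def)
    moreover have "(\<Sum>n = m - 2..m + 1. c n * a n m) = (\<Sum>n\<le>m + 1. c n * a n m)"
      by (rule sum.mono_neutral_left) (auto simp: a_def e'_def)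
    ultimately show ?thesis by simp
  qed
  ultimately show ?thesis
    unfolding formal_solution_def by blast
qed

section \<open>The q-hypergeometric series\<close>

theorem theorem3p3:
  fixes q lq lam :: complex
    and h l \<alpha> t :: "nat \<Rightarrow> complex"
    and i i' :: nat
    and X :: "complex \<Rightarrow> complex"
  assumes log_q: "exp lq = q"
    and not_root_of_unity: "\<forall>n>0. q ^ n \<noteq> 1"
    and t_nonzero: "t 1 \<noteq> 0" "t 2 \<noteq> 0"
    and lam: "lam = (h 1 + h 2 - l 1 - l 2 - \<alpha> 1 - \<alpha> 2 + 1) / 2"
    and ii': "(i, i') = (1, 2) \<or> (i, i') = (2, 1)"
    and denominators:
      "\<forall>n. qpoch (qpow lq (h i - l i + 1)) q n \<noteq> 0"
      "\<forall>n. qpoch (qpow lq (h i' - l i + 1) * t i' / t i) q n \<noteq> 0"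
    and X: "power_function q lq lam X"
  shows "formal_solution (qhyp2_operator q lq h l \<alpha> t) X
           (\<lambda>n x. qpoch (x / (qpow lq (l i - 1/2) * t i)) q n)
           (\<lambda>n. qpoch (qpow lq (lam + \<alpha> 1)) q n * qpoch (qpow lq (lam + \<alpha> 2)) q n
                / (qpoch (qpow lq (h i - l i + 1)) q n
                   * qpoch (qpow lq (h i' - l i + 1) * t i' / t i) q n
                   * qpoch q q n)
                * q ^ n)"
proof -
  define b where "b = qpow lq (l i - 1/2) * t i"
  define U where "U = qpow lq (h i - l i)"
  define V where "V = qpow lq (h i' - l i) * t i' / t i"
  define A where "A = qpow lq (lam + \<alpha> 1)"
  define C where "C = qpow lq (lam + \<alpha> 2)"
  define P where "P n x = qpoch (x / b) q n" for n x
  define c where "c n = qpoch A q n * qpoch C q n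
    / (qpoch (U * q) q n * qpoch (V * q) q n * qpoch q q n) * q ^ n" for n
  define \<beta> where "\<beta> n = qpow lq (- lam) * inverse (q ^ n) * ((1 - A * q ^ n) * (1 - C * q ^ n))" for n
  define \<delta> where "\<delta> n = qpow lq (- lam) * inverse (q ^ n) *
    ((1 - q ^ n) * (1 - U * q ^ n) * (1 - V * q ^ n))" for n
  define e where "e n m = b\<^sup>2 * (inverse (q ^ n))\<^sup>2 *
    (if m = n then 1 else if m = Suc n then - (1 + inverse q) else inverse q)" for n m :: nat
  have q: "q \<noteq> 0" using log_q by auto
  have b: "b \<noteq> 0" using t_nonzero ii' by (auto simp: b_def)
  have Uq: "qpow lq (h i - l i + 1) = U * q"
    using log_q by (simp add: U_def qpow_add qpow_one)
  have Vq: "qpow lq (h i' - l i + 1) * t i' / t i = V * q"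
    using log_q by (simp add: V_def qpow_add qpow_one)
  have "formal_solution (qhyp2_operator q lq h l \<alpha> t) X P c"
  proof (rule formal_solution_if_telescoping)
    fix n x
    have "x\<^sup>2 * P n x = b\<^sup>2 * ((x / b)\<^sup>2 * qpoch (x / b) q n)"
      using b by (simp add: P_def power_divide)
    also have "\<dots> = e n n * P n x + e n (Suc n) * P (Suc n) x
        + e n (Suc (Suc n)) * P (Suc (Suc n)) x"
      unfolding square_times_qpoch[OF q] by (simp add: e_def P_def algebra_simps)
    also have "\<dots> = (\<Sum>m = n..n + 2. e n m * P m x)"
      by (simp add: numeral_2_eq_2)
    finally show "x\<^sup>2 * P n x = (\<Sum>m = n..n + 2. e n m * P m x)" .
  next
    fix n and x :: complex
    assume x: "x \<noteq> 0"
    have shifts: "P n (x / q) = qpoch (x / b / q) q n" "P n (q * x) = qpoch (q * (x / b)) q n"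
      by (simp_all add: P_def mult.commute)
    have "qhyp2_operator q lq h l \<alpha> t (\<lambda>y. X y * P n y) x =
      X x * (b\<^sup>2 * qpow lq (- lam) * ((x / b)\<^sup>2 * inverse (q ^ n) *
        ((1 - A * q ^ n) * (1 - C * q ^ n) * P n x
         - (1 - q ^ n) * (1 - U * q ^ n) * (1 - V * q ^ n) * P (n - 1) x)))"
      unfolding qhyp2_operator_normalized[OF log_q t_nonzero lam ii' X x, of "P n",
          folded b_def U_def V_def A_def C_def] shifts
      unfolding P_def two_term_action[OF q] ..
    also have "\<dots> = X x * (qpow lq (- lam) * inverse (q ^ n) * (b\<^sup>2 * (x / b)\<^sup>2) *
        ((1 - A * q ^ n) * (1 - C * q ^ n) * P n x
         - (1 - q ^ n) * (1 - U * q ^ n) * (1 - V * q ^ n) * P (n - 1) x))"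
      by (simp only: mult_ac)
    also have "b\<^sup>2 * (x / b)\<^sup>2 = x\<^sup>2"
      using b by (simp add: power_divide)
    also have "X x * (qpow lq (- lam) * inverse (q ^ n) * x\<^sup>2 *
        ((1 - A * q ^ n) * (1 - C * q ^ n) * P n x
         - (1 - q ^ n) * (1 - U * q ^ n) * (1 - V * q ^ n) * P (n - 1) x)) =
      X x * (\<beta> n * (x\<^sup>2 * P n x) - \<delta> n * (x\<^sup>2 * P (n - 1) x))"
      by (simp only: \<beta>_def \<delta>_def algebra_simps)
    finally show "qhyp2_operator q lq h l \<alpha> t (\<lambda>y. X y * P n y) x =
      X x * (\<beta> n * (x\<^sup>2 * P n x) - \<delta> n * (x\<^sup>2 * P (n - 1) x))" .
  next
    show "\<delta> 0 = 0" by (simp add: \<delta>_def)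
  next
    fix n
    define u v w where uvw: "u = 1 - U * (q * q ^ n)" "v = 1 - V * (q * q ^ n)" "w = 1 - q * q ^ n"
    have "qpoch (U * q) q (Suc n) \<noteq> 0" "qpoch (V * q) q (Suc n) \<noteq> 0"
      using denominators unfolding Uq Vq by blast+
    then have nz: "qpoch (U * q) q n \<noteq> 0" "u \<noteq> 0" "qpoch (V * q) q n \<noteq> 0" "v \<noteq> 0"
      by (auto simp: qpoch_Suc uvw mult.assoc)
    have "qpoch q q (Suc n) \<noteq> 0"
      by (rule qpoch_self_nonzero[OF not_root_of_unity])
    then have nz': "qpoch q q n \<noteq> 0" "w \<noteq> 0"
      by (auto simp: qpoch_Suc uvw)
    have cS: "c (Suc n) = qpoch A q n * (1 - A * q ^ n) * (qpoch C q n * (1 - C * q ^ n))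
        / (qpoch (U * q) q n * u * (qpoch (V * q) q n * v) * (qpoch q q n * w)) * (q * q ^ n)"
      by (simp add: c_def qpoch_Suc uvw mult.assoc)
    have \<delta>S: "\<delta> (Suc n) = qpow lq (- lam) * inverse (q * q ^ n) * (w * u * v)"
      by (simp add: \<delta>_def uvw)
    show "c (Suc n) * \<delta> (Suc n) = c n * \<beta> n"
      unfolding cS \<delta>S unfolding c_def \<beta>_def using nz nz' q by (simp add: divide_simps)
  qed
  moreover have "(\<lambda>n x. qpoch (x / (qpow lq (l i - 1/2) * t i)) q n) = P"
    by (intro ext) (simp add: P_def b_def)
  ultimately show ?thesis
    unfolding Uq Vq c_def A_def C_def by simp
qed

end
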